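(* Let $n,t$ be positive integers and let $k_1,\ldots,k_t\in[n]=\{1,\ldots,n\}$. Then the incidence bigraph $G$ of the complete hypergraph on $n$ vertices and in uniformities $k_1,\ldots,k_t$, defined by $$V_1(G)=[n],\qquad V_2(G)=\left\{(U,i) : i\in[t],\ U\in\binom{[n]}{k_i}\right\},\qquad E(G)=\left\{(v,(U,i)) : i\in[t],\ U\in\binom{[n]}{k_i},\ v\in U\right\},$$ is (up to isomorphism) a left-reflection bigraph.
   Context: $\binom{[n]}{k}$ is the set of $k$-element subsets of $[n]$. A bigraph is a triple $G=(V_1,V_2,E)$ with $V_1,V_2$ disjoint finite sets and $E\subseteq V_1\times V_2$; write $V_i(G)=V_i$, $E(G)=E$. An isomorphism of bigraphs is a bijection of vertex sets mapping $V_1$ to $V_1$ and $V_2$ to $V_2$ and preserving edges and non-edges. Reflection groups. Let $R\subseteq \mathrm{GL}_m(\mathbb{R})$ be a finite group generated by (orthogonal) reflections and let $T\subseteq R$ be the set of reflections in $R$. The root system $\Phi$ is the set of unit vectors orthogonal to some hyperplane fixed by an element of $T$. Given an ordered basis $(u_1,\ldots,u_m)$ of $\mathbb{R}^m$, a root $\alpha=\sum_i c_iu_i$ is positive if $c_{i_0}>0$ for the first index $i_0$ with $c_{i_0}\neq 0$; $\Phi^+$ is the set of positive roots. The simple system $\Delta\subseteq\Phi^+$ is the (unique) minimal subset of $\Phi^+$ such that every positive root is a linear combination with non-negative coefficients of elements of $\Delta$; the set of simple reflections is $S_\Delta=\{s_\alpha:\alpha\in\Delta\}$, where $s_\alpha$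 is the reflection on the hyperplane orthogonal to $\alpha$. $S_\Delta$ generates $R$. Left-reflection bigraphs. For $k\geq 1$ and $S_0,S_1,\ldots,S_k\subseteq S_\Delta$, let $R_i$ be the subgroup of $R$ generated by $S_i$. The $(S_0;S_1,\ldots,S_k;S_\Delta)$-left-reflection bigraph is the bigraph with left vertex set $R/R_0=\{rR_0: r\in R\}$ (left cosets), right vertex set $\{(rR_i,i): r\in R, 1\leq i\leq k\}$ and edge set $\{(rR_0,(rR_i,i)): r\in R, 1\leq i\leq k\}$. A left-reflection bigraph is any bigraph arising this way (for some finite reflection group $R$, ordered basis, and $S_0,\ldots,S_k\subseteq S_\Delta$). *)

theory Defs
  imports "Jordan_Normal_Form.VS_Connect" "HOL-Algebra.Generated_Groups"
begin

section \<open>Bigraphs\<close>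

text \<open>The two sides have separate vertex types, so they are disjoint by typing, and a bijection of
  vertex sets that respects the two sides is a pair of bijections.\<close>

record ('a, 'b) bigraph =
  left_verts :: "'a set"
  right_verts :: "'b set"
  edges :: "('a \<times> 'b) set"

definition is_bigraph :: "('a, 'b) bigraph \<Rightarrow> bool" where
  "is_bigraph G \<longleftrightarrow> finite (left_verts G) \<and> finite (right_verts G) \<and>
     edges G \<subseteq> left_verts G \<times> right_verts G"

definition bigraph_iso :: "('a, 'b) bigraph \<Rightarrow> ('c, 'd) bigraph \<Rightarrow> bool" where
  "bigraph_iso G H \<longleftrightarrow> is_bigraph G \<and> is_bigraph H \<and>
     (\<exists>f g. bij_betw f (left_verts G) (left_verts H) \<and>
            bij_betw g (right_verts G) (right_verts H) \<and>
            (\<forall>x \<in> left_verts G. \<forall>y \<in> right_verts G.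
               (x, y) \<in> edges G \<longleftrightarrow> (f x, g y) \<in> edges H))"

section \<open>Finite reflection groups\<close>

definition GL :: "nat \<Rightarrow> real mat monoid" where
  "GL m = units_of (ring_mat TYPE(real) m ())"

definition refl_mat :: "nat \<Rightarrow> real vec \<Rightarrow> real mat" where
  "refl_mat m \<alpha> = mat m m (\<lambda>(i, j). (if i = j then 1 else 0) - 2 * (\<alpha> $ i) * (\<alpha> $ j) / (\<alpha> \<bullet> \<alpha>))"

lemma refl_mat_mult_vec:
  assumes "\<alpha> \<in> carrier_vec m" "v \<in> carrier_vec m"
  shows "refl_mat m \<alpha> *\<^sub>v v = v - (2 * (\<alpha> \<bullet> v) / (\<alpha> \<bullet> \<alpha>)) \<cdot>\<^sub>v \<alpha>"
proof (rule eq_vecI)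
  fix i assume "i < dim_vec (v - (2 * (\<alpha> \<bullet> v) / (\<alpha> \<bullet> \<alpha>)) \<cdot>\<^sub>v \<alpha>)"
  then have i: "i < m" using assms by simp
  define c where "c = 2 * (\<alpha> $ i) / (\<alpha> \<bullet> \<alpha>)"
  have "(refl_mat m \<alpha> *\<^sub>v v) $ i =
      (\<Sum>j<m. ((if i = j then 1 else 0) - c * (\<alpha> $ j)) * (v $ j))"
    using i assms by (simp add: refl_mat_def scalar_prod_def c_def atLeast0LessThan)
  also have "\<dots> = (\<Sum>j<m. (if i = j then v $ j else 0)) - c * (\<Sum>j<m. (\<alpha> $ j) * (v $ j))"
    unfolding sum_distrib_left sum_subtractf[symmetric]
    by (rule sum.cong) (auto simp: algebra_simps)
  also have "\<dots> = v $ i - c * (\<alpha> \<bullet> v)"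
    using i assms by (simp add: scalar_prod_def atLeast0LessThan)
  finally show "(refl_mat m \<alpha> *\<^sub>v v) $ i = (v - (2 * (\<alpha> \<bullet> v) / (\<alpha> \<bullet> \<alpha>)) \<cdot>\<^sub>v \<alpha>) $ i"
    using i assms by (simp add: c_def)
qed (use assms in \<open>simp add: refl_mat_def\<close>)

definition reflections :: "nat \<Rightarrow> real mat set" where
  "reflections m = {refl_mat m \<alpha> | \<alpha>. \<alpha> \<in> carrier_vec m \<and> \<alpha> \<noteq> 0\<^sub>v m}"

definition finite_reflection_group :: "nat \<Rightarrow> real mat set \<Rightarrow> bool" where
  "finite_reflection_group m R \<longleftrightarrow>
     finite R \<and> (\<exists>T \<subseteq> reflections m. R = generate (GL m) T)"

section \<open>Roots and simple systems\<close>

text \<open>Hyperplanes are required to be fixed pointwise: a reflection also maps every hyperplane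
  that contains its normal vector to itself.\<close>

definition root_system :: "nat \<Rightarrow> real mat set \<Rightarrow> real vec set" where
  "root_system m R = {\<alpha> \<in> carrier_vec m. \<alpha> \<bullet> \<alpha> = 1 \<and>
     (\<exists>s \<in> R \<inter> reflections m. \<forall>v \<in> carrier_vec m. \<alpha> \<bullet> v = 0 \<longrightarrow> s *\<^sub>v v = v)}"

abbreviation vec_lincomb :: "nat \<Rightarrow> (real vec \<Rightarrow> real) \<Rightarrow> real vec set \<Rightarrow> real vec" where
  "vec_lincomb m \<equiv> module.lincomb (module_vec TYPE(real) m)"

definition ordered_basis :: "nat \<Rightarrow> real vec list \<Rightarrow> bool" where
  "ordered_basis m us \<longleftrightarrow> distinct us \<and>
     vectorspace.basis class_ring (module_vec TYPE(real) m) (set us)"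

definition positive_roots :: "nat \<Rightarrow> real mat set \<Rightarrow> real vec list \<Rightarrow> real vec set" where
  "positive_roots m R us = {\<alpha> \<in> root_system m R.
     \<exists>c. \<alpha> = vec_lincomb m c (set us) \<and>
         (\<exists>i < length us. c (us ! i) > 0 \<and> (\<forall>j < i. c (us ! j) = 0))}"

definition nonneg_spans :: "nat \<Rightarrow> real vec set \<Rightarrow> real vec set \<Rightarrow> bool" where
  "nonneg_spans m D P \<longleftrightarrow>
     (\<forall>\<alpha> \<in> P. \<exists>c. (\<forall>\<beta> \<in> D. c \<beta> \<ge> 0) \<and> \<alpha> = vec_lincomb m c D)"

definition simple_system :: "nat \<Rightarrow> real vec set \<Rightarrow> real vec set \<Rightarrow> bool" where
  "simple_system m P \<Delta> \<longleftrightarrow> \<Delta> \<subseteq> P \<and> nonneg_spans m \<Delta> P \<and>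
     (\<forall>D. D \<subset> \<Delta> \<longrightarrow> \<not> nonneg_spans m D P)"

section \<open>Left-reflection bigraphs\<close>

text \<open>\<open>S 0\<close> gives the left vertices and \<open>S 1, \<dots>, S k\<close> give the right vertices.\<close>

definition coset_bigraph ::
  "nat \<Rightarrow> real mat set \<Rightarrow> (nat \<Rightarrow> real mat set) \<Rightarrow> nat \<Rightarrow> (real mat set, real mat set \<times> nat) bigraph"
where
  "coset_bigraph m R S k =
     (let coset = (\<lambda>r i. r <#\<^bsub>GL m\<^esub> generate (GL m) (S i)) in
      \<lparr>left_verts = {coset r 0 | r. r \<in> R},
       right_verts = {(coset r i, i) | r i. r \<in> R \<and> i \<in> {1..k}},
       edges = {(coset r 0, (coset r i, i)) | r i. r \<in> R \<and> i \<in> {1..k}}\<rparr>)"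

definition left_reflection_bigraph :: "(real mat set, real mat set \<times> nat) bigraph \<Rightarrow> bool" where
  "left_reflection_bigraph G \<longleftrightarrow>
     (\<exists>m R us \<Delta> k S.
        m \<ge> 1 \<and> finite_reflection_group m R \<and> ordered_basis m us \<and>
        simple_system m (positive_roots m R us) \<Delta> \<and>
        k \<ge> 1 \<and> (\<forall>i \<le> k. S i \<subseteq> refl_mat m ` \<Delta>) \<and>
        G = coset_bigraph m R S k)"

section \<open>Complete hypergraphs\<close>

definition complete_incidence_bigraph ::
  "nat \<Rightarrow> nat \<Rightarrow> (nat \<Rightarrow> nat) \<Rightarrow> (nat, nat set \<times> nat) bigraph"
where
  "complete_incidence_bigraph n t k =
     \<lparr>left_verts = {1..n},
      right_verts = {(U, i). i \<in> {1..t} \<and> U \<subseteq> {1..n} \<and> card U = k i},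
      edges = {(v, (U, i)). i \<in> {1..t} \<and> U \<subseteq> {1..n} \<and> card U = k i \<and> v \<in> U}\<rparr>"

end

theory Submission
  imports Defs "HOL-Combinatorics.Permutations"
begin

text \<open>Let the symmetric group act on \<open>\<real>\<^sup>n\<close> by permutation matrices. With respect to the standard basis
  its simple roots are \<open>(e\<^sub>i - e\<^sub>i\<^sub>+\<^sub>1) / \<surd>2\<close>, so its simple reflections are the adjacent transpositions.
  Omitting the one that exchanges the \<open>k\<close>-th and the \<open>(k + 1)\<close>-th basis vector leaves generators of the
  stabilizer of the first \<open>k\<close> points, whose left cosets correspond to the \<open>k\<close>-subsets. The choice \<open>k = 1\<close>
  gives the left vertices; a coset of type \<open>1\<close> meets a coset of type \<open>k\<close> iff the point lies in the subset.\<close>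

section \<open>Permutation matrices\<close>

text \<open>Column \<open>j\<close> has its 1 in row \<open>p j\<close>, so the matrix sends the
  \<open>j\<close>-th basis vector to the \<open>p j\<close>-th. With this convention matrix
  products follow composition in the same order.\<close>

definition perm_mat :: "nat \<Rightarrow> (nat \<Rightarrow> nat) \<Rightarrow> real mat" where
  "perm_mat n p = mat n n (\<lambda>(i, j). if i = p j then 1 else 0)"

lemma perm_mat_carrier [simp]: "perm_mat n p \<in> carrier_mat n n"
  by (simp add: perm_mat_def)

lemma perm_mat_mult:
  assumes "p permutes {..<n}" "q permutes {..<n}"
  shows "perm_mat n p * perm_mat n q = perm_mat n (p \<circ> q)"
proof (rule eq_matI)
  fix i j assume "i < dim_row (perm_mat n (p \<circ> q))" "j < dim_col (perm_mat n (p \<circ> q))"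
  then have ij: "i < n" "j < n" by (auto simp: perm_mat_def)
  have qj: "q j < n" using permutes_in_image[OF assms(2), of j] ij by simp
  have "(perm_mat n p * perm_mat n q) $$ (i, j)
      = (\<Sum>l<n. (if i = p l then 1 else 0) * (if l = q j then 1 else 0))"
    using ij by (simp add: perm_mat_def scalar_prod_def atLeast0LessThan)
  also have "\<dots> = (\<Sum>l<n. if l = q j then (if i = p (q j) then 1 else 0) else 0)"
    by (rule sum.cong) auto
  finally show "(perm_mat n p * perm_mat n q) $$ (i, j) = perm_mat n (p \<circ> q) $$ (i, j)"
    using ij qj by (simp add: perm_mat_def)
qed (auto simp: perm_mat_def)

lemma perm_mat_id: "perm_mat n id = 1\<^sub>m n"
  by (rule eq_matI) (auto simp: perm_mat_def)

lemma perm_mat_inj: "inj_on (perm_mat n) {p. p permutes {..<n}}"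
proof (rule inj_onI, rule ext)
  fix p q j
  assume p: "p \<in> {p. p permutes {..<n}}" and q: "q \<in> {p. p permutes {..<n}}"
    and eq: "perm_mat n p = perm_mat n q"
  show "p j = q j"
  proof (cases "j < n")
    case True
    then have "p j < n" using p permutes_in_image[of p "{..<n}" j] by simp
    with True have "perm_mat n p $$ (p j, j) = 1" by (simp add: perm_mat_def)
    then have "perm_mat n q $$ (p j, j) = 1" using eq by simp
    with True \<open>p j < n\<close> show ?thesis by (simp add: perm_mat_def split: if_splits)
  next
    case False
    with p q show ?thesis using permutes_not_in[of p "{..<n}" j] permutes_not_in[of q "{..<n}" j] by simp
  qed
qed

lemma perm_mat_mult_vec:
  assumes "p permutes {..<n}" "v \<in> carrier_vec n" "j < n"
  shows "(perm_mat n p *\<^sub>v v) $ (p j) = v $ j"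
proof -
  have pj: "p j < n" using permutes_in_image[OF assms(1), of j] assms(3) by simp
  have "(perm_mat n p *\<^sub>v v) $ (p j) = (\<Sum>l<n. (if p j = p l then 1 else 0) * v $ l)"
    using assms pj by (simp add: perm_mat_def scalar_prod_def atLeast0LessThan)
  also have "\<dots> = (\<Sum>l<n. if j = l then v $ l else 0)"
    by (rule sum.cong) (auto simp: inj_eq[OF permutes_inj[OF assms(1)]])
  finally show ?thesis using assms(3) by simp
qed

section \<open>Permutation matrices in the general linear group\<close>

lemma GL_group: "group (GL n)"
  unfolding GL_def by (rule monoid.units_group) (rule ring.is_monoid[OF ring_mat])

lemma GL_mult [simp]: "A \<otimes>\<^bsub>GL n\<^esub> B = A * B"
  by (simp add: GL_def units_of_def ring_mat_def)

lemma GL_one [simp]: "\<one>\<^bsub>GL n\<^esub> = 1\<^sub>m n"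
  by (simp add: GL_def units_of_def ring_mat_def)

lemma perm_mat_inverse:
  assumes "p permutes {..<n}"
  shows "perm_mat n (Hilbert_Choice.inv p) * perm_mat n p = 1\<^sub>m n"
    and "perm_mat n p * perm_mat n (Hilbert_Choice.inv p) = 1\<^sub>m n"
  using assms
  by (simp_all add: perm_mat_mult permutes_inv permutes_inv_o perm_mat_id)

lemma perm_mat_in_GL:
  assumes "p permutes {..<n}"
  shows "perm_mat n p \<in> carrier (GL n)"
  using perm_mat_inverse[OF assms] perm_mat_carrier[of n p] perm_mat_carrier[of n "Hilbert_Choice.inv p"]
  unfolding GL_def units_of_def Units_def ring_mat_def by auto

lemma perm_mat_inv:
  assumes "p permutes {..<n}"
  shows "inv\<^bsub>GL n\<^esub> perm_mat n p = perm_mat n (Hilbert_Choice.inv p)"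
  by (rule group.inv_equality[OF GL_group])
    (simp_all add: assms perm_mat_inverse perm_mat_in_GL permutes_inv)

section \<open>Parabolic subgroups and their cosets\<close>

text \<open>Permutations act on \<open>{..<n}\<close>, while the hypergraph has vertex set \<open>{1..n}\<close>; the successor
  function in the next definition translates between the two.\<close>

definition perm_coset :: "nat \<Rightarrow> nat \<Rightarrow> nat set \<Rightarrow> real mat set" where
  "perm_coset n k U = perm_mat n ` {p. p permutes {..<n} \<and> Suc ` p ` {..<k} = U}"

text \<open>With points counted from 0, swapping \<open>i\<close> and \<open>Suc i\<close> crosses
  the boundary of \<open>{..<k}\<close> exactly when \<open>Suc i = k\<close>. For
  \<open>k = n\<close> all adjacent transpositions remain.\<close>

definition block_gens :: "nat \<Rightarrow> nat \<Rightarrow> real mat set" where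
  "block_gens n k = {perm_mat n (Transposition.transpose i (Suc i)) | i. Suc i < n \<and> Suc i \<noteq> k}"

text \<open>Supplies the upper bound in \<open>generate_block_gens\<close>: a subgroup containing
  the generators contains all that they generate.\<close>

lemma stabilizer_subgroup:
  "subgroup (perm_mat n ` {p. p permutes {..<n} \<and> p ` K = K}) (GL n)"
proof (rule group.subgroupI[OF GL_group])
  show "perm_mat n ` {p. p permutes {..<n} \<and> p ` K = K} \<subseteq> carrier (GL n)"
    by (auto simp: perm_mat_in_GL)
  have "id permutes {..<n} \<and> id ` K = K" by simp
  then show "perm_mat n ` {p. p permutes {..<n} \<and> p ` K = K} \<noteq> {}" by blast
next
  fix a assume "a \<in> perm_mat n ` {p. p permutes {..<n} \<and> p ` K = K}"
  then obtain p where p: "p permutes {..<n}" "p ` K = K" "a = perm_mat n p" by auto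
  have "Hilbert_Choice.inv p ` (p ` K) = K"
    using permutes_inj[OF p(1)] by (simp add: image_comp)
  then have "Hilbert_Choice.inv p ` K = K" using p(2) by simp
  then show "inv\<^bsub>GL n\<^esub> a \<in> perm_mat n ` {p. p permutes {..<n} \<and> p ` K = K}"
    using p by (auto simp: perm_mat_inv permutes_inv)
next
  fix a b
  assume "a \<in> perm_mat n ` {p. p permutes {..<n} \<and> p ` K = K}"
    "b \<in> perm_mat n ` {p. p permutes {..<n} \<and> p ` K = K}"
  then obtain p q where p: "p permutes {..<n}" "p ` K = K" "a = perm_mat n p"
    and q: "q permutes {..<n}" "q ` K = K" "b = perm_mat n q" by auto
  have "(p \<circ> q) permutes {..<n}" using q(1) p(1) by (rule permutes_compose)
  moreover have "(p \<circ> q) ` K = K" unfolding image_comp[symmetric] q(2) by (rule p(2))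
  ultimately have "perm_mat n (p \<circ> q) \<in> perm_mat n ` {p. p permutes {..<n} \<and> p ` K = K}" by blast
  then show "a \<otimes>\<^bsub>GL n\<^esub> b \<in> perm_mat n ` {p. p permutes {..<n} \<and> p ` K = K}"
    using p q by (simp add: perm_mat_mult)
qed

text \<open>Every permutation of an interval is a product of transpositions, and each of these is
  reached from adjacent ones by repeated conjugation. The interval form serves both blocks
  \<open>{0..<k}\<close> and \<open>{k..<n}\<close>.\<close>

lemma perm_mat_in_generate:
  assumes adj: "\<And>i. a \<le> i \<Longrightarrow> Suc i < b \<Longrightarrow> perm_mat n (Transposition.transpose i (Suc i)) \<in> T"
    and "b \<le> n" and p: "p permutes {a..<b}"
  shows "perm_mat n p \<in> generate (GL n) T"
proof -
  let ?H = "generate (GL n) T"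
  have mult: "perm_mat n (p \<circ> q) \<in> ?H"
    if "perm_mat n p \<in> ?H" "perm_mat n q \<in> ?H" "p permutes {..<n}" "q permutes {..<n}" for p q
    using generate.eng[OF that(1,2)] that(3,4) by (simp add: perm_mat_mult)
  have transp: "perm_mat n (Transposition.transpose i (i + Suc d)) \<in> ?H"
    if "a \<le> i" "i + Suc d < b" for i d
    using that
  proof (induction d)
    case 0
    then show ?case using adj[of i] by (simp add: generate.incl)
  next
    case (Suc d)
    let ?l = "i + Suc d"
    \<comment> \<open>Conjugating by the adjacent transposition at \<open>?l\<close> lengthens the
      swap by one, which drives the induction on the distance.\<close>
    have eq: "Transposition.transpose i (Suc ?l) =
        Transposition.transpose ?l (Suc ?l) \<circ> (Transposition.transpose i ?l \<circ> Transposition.transpose ?l (Suc ?l))"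
      by (auto simp: fun_eq_iff Transposition.transpose_def)
    have s: "perm_mat n (Transposition.transpose ?l (Suc ?l)) \<in> ?H"
      using adj[of ?l] Suc.prems by (simp add: generate.incl)
    have perm: "Transposition.transpose ?l (Suc ?l) permutes {..<n}"
      "Transposition.transpose i ?l permutes {..<n}"
      using Suc.prems \<open>b \<le> n\<close> by (auto intro!: permutes_swap_id)
    have "perm_mat n (Transposition.transpose i (Suc ?l)) \<in> ?H"
      unfolding eq using Suc.prems Suc.IH s perm
      by (intro mult permutes_compose) auto
    then show ?case by simp
  qed
  have transp': "perm_mat n (Transposition.transpose i j) \<in> ?H"
    if "a \<le> i" "i < j" "j < b" for i j
    using transp[of i "j - Suc i"] that by simp
  have sub: "{a..<b} \<subseteq> {..<n}" using \<open>b \<le> n\<close> by auto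
  show ?thesis using p finite_atLeastLessThan
  proof (induction rule: permutes_induct)
    case id
    show ?case using generate.one[of "GL n" T] by (simp add: perm_mat_id[unfolded id_def] id_def)
  next
    case (swap i j p)
    have "perm_mat n (Transposition.transpose i j) \<in> ?H"
    proof (cases "i < j")
      case True
      then show ?thesis using transp' swap(1,2) by simp
    next
      case False
      then show ?thesis using transp'[of j i] swap(1-3) by (simp add: transpose_commute)
    qed
    moreover have "Transposition.transpose i j permutes {..<n}"
      using swap sub by (intro permutes_swap_id) auto
    ultimately show ?case using swap permutes_subset[OF \<open>p permutes {a..<b}\<close> sub] by (intro mult) auto
  qed
qed

text \<open>A permutation preserving \<open>{..<k}\<close> also preserves \<open>{k..<n}\<close>, so
  it splits into one permutation of each block, and the adjacent transpositions inside a block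
  generate all permutations of that block.\<close>

lemma generate_block_gens:
  assumes "k \<le> n"
  shows "generate (GL n) (block_gens n k) = perm_mat n ` {p. p permutes {..<n} \<and> p ` {..<k} = {..<k}}"
    (is "?L = ?R")
proof
  have "Transposition.transpose i (Suc i) ` {..<k} = {..<k}" if "Suc i \<noteq> k" for i
    using that by (cases "Suc i < k") (auto simp: transpose_image_eq)
  then have "block_gens n k \<subseteq> ?R"
    by (auto simp: block_gens_def intro!: imageI permutes_swap_id)
  then show "?L \<subseteq> ?R"
    by (rule group.generate_subgroup_incl[OF GL_group _ stabilizer_subgroup])
next
  show "?R \<subseteq> ?L"
  proof clarify
    fix p assume p: "p permutes {..<n}" "p ` {..<k} = {..<k}"
    \<comment> \<open>\<open>q\<close> carries the action of \<open>p\<close> on the lower block and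
      \<open>r\<close> that on the upper block; each is the identity elsewhere.\<close>
    define q where "q x = (if x < k then p x else x)" for x
    define r where "r x = (if x < k then x else p x)" for x
    have inj: "inj p" using p(1) by (rule permutes_inj)
    have lt: "p x < k \<longleftrightarrow> x < k" for x
      using p(2) inj inj_image_mem_iff[of p x "{..<k}"] by simp
    have pn: "p x < n \<longleftrightarrow> x < n" for x
      using permutes_in_image[OF p(1), of x] by simp
    have q: "q permutes {0..<k}"
    proof (rule bij_imp_permutes)
      have "bij_betw p {0..<k} {0..<k}"
        using p(2) inj_on_subset[OF inj subset_UNIV] by (simp add: bij_betw_def atLeast0LessThan)
      then show "bij_betw q {0..<k} {0..<k}"
        by (rule bij_betw_cong[THEN iffD1, rotated]) (simp add: q_def)
    qed (auto simp: q_def)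
    have r: "r permutes {k..<n}"
    proof (rule bij_imp_permutes)
      have "r x \<in> {k..<n}" if "x \<in> {k..<n}" for x
        using lt[of x] pn[of x] that by (simp add: r_def)
      then have "r ` {k..<n} \<subseteq> {k..<n}" by blast
      moreover have "inj_on r {k..<n}" by (rule inj_onI) (simp add: r_def inj_eq[OF inj])
      ultimately show "bij_betw r {k..<n} {k..<n}"
        by (simp add: bij_betw_def endo_inj_surj)
      show "r x = x" if "x \<notin> {k..<n}" for x
        using that p(1) by (auto simp: r_def intro: permutes_not_in)
    qed
    have "p = q \<circ> r" using lt by (auto simp: fun_eq_iff q_def r_def)
    moreover have "perm_mat n q \<in> ?L"
      by (rule perm_mat_in_generate[OF _ assms q]) (use assms in \<open>auto simp: block_gens_def\<close>)
    moreover have "perm_mat n r \<in> ?L"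
      by (rule perm_mat_in_generate[OF _ order.refl r]) (auto simp: block_gens_def)
    moreover have "q permutes {..<n}" using q by (rule permutes_subset) (use assms in auto)
    moreover have "r permutes {..<n}" using r by (rule permutes_subset) auto
    ultimately show "perm_mat n p \<in> ?L"
      using generate.eng[of "perm_mat n q" "GL n" "block_gens n k" "perm_mat n r"]
      by (simp add: perm_mat_mult)
  qed
qed

text \<open>\<open>q\<close> lies in the coset of \<open>p\<close> iff
  \<open>inv p \<circ> q\<close> preserves \<open>{..<k}\<close>, that is, iff \<open>p\<close> and
  \<open>q\<close> map \<open>{..<k}\<close> to the same set. So the coset records exactly this
  image.\<close>

lemma l_coset_block_gens:
  assumes "k \<le> n" "p permutes {..<n}"
  shows "perm_mat n p <#\<^bsub>GL n\<^esub> generate (GL n) (block_gens n k) = perm_coset n k (Suc ` p ` {..<k})"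
proof -
  have "{p \<circ> q | q. q permutes {..<n} \<and> q ` {..<k} = {..<k}} =
      {q. q permutes {..<n} \<and> q ` {..<k} = p ` {..<k}}" (is "?A = ?B")
  proof
    show "?A \<subseteq> ?B"
    proof clarify
      fix q assume q: "q permutes {..<n}" "q ` {..<k} = {..<k}"
      have "(p \<circ> q) ` {..<k} = p ` {..<k}"
        unfolding image_comp[symmetric] q(2) by (rule refl)
      then show "(p \<circ> q) permutes {..<n} \<and> (p \<circ> q) ` {..<k} = p ` {..<k}"
        using q assms(2) by (blast intro: permutes_compose)
    qed
    show "?B \<subseteq> ?A"
    proof
      fix q assume q: "q \<in> ?B"
      have "q = p \<circ> (Hilbert_Choice.inv p \<circ> q)"
        using permutes_inv_o(1)[OF assms(2)] by (simp add: o_assoc)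
      moreover have "(Hilbert_Choice.inv p \<circ> q) permutes {..<n}"
        using q assms(2) by (auto intro: permutes_compose permutes_inv)
      moreover have "(Hilbert_Choice.inv p \<circ> q) ` {..<k} = {..<k}"
      proof -
        have qk: "q ` {..<k} = p ` {..<k}" using q by blast
        show ?thesis
          unfolding image_comp[symmetric] qk using permutes_inj[OF assms(2)] by (simp add: image_comp)
      qed
      ultimately show "q \<in> ?A" by blast
    qed
  qed
  \<comment> \<open>\<open>Suc\<close> is injective, so the shift in \<open>perm_coset\<close> does
    not affect equality of images.\<close>
  then have "perm_mat n ` ?A = perm_coset n k (Suc ` p ` {..<k})"
    by (simp add: perm_coset_def inj_image_eq_iff)
  moreover have "perm_mat n p <#\<^bsub>GL n\<^esub> generate (GL n) (block_gens n k) = perm_mat n ` ?A"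
    using assms by (auto simp: generate_block_gens l_coset_def perm_mat_mult)
  ultimately show ?thesis by simp
qed

section \<open>Roots of the symmetric group\<close>

text \<open>The factor \<open>1 / sqrt 2\<close> normalizes the length, since
  \<open>root_system\<close> consists of unit vectors.\<close>

definition root_vec :: "nat \<Rightarrow> nat \<Rightarrow> nat \<Rightarrow> real vec" where
  "root_vec n i j = (1 / sqrt 2) \<cdot>\<^sub>v (unit_vec n i - unit_vec n j)"

lemma root_vec_carrier [simp]: "root_vec n i j \<in> carrier_vec n"
  by (simp add: root_vec_def)

lemma root_vec_index:
  assumes "a < n"
  shows "root_vec n i j $ a = ((if a = i then 1 else 0) - (if a = j then 1 else 0)) / sqrt 2"
  using assms by (simp add: root_vec_def unit_vec_def)

lemma scalar_prod_root_vec: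
  assumes "i < n" "j < n" "v \<in> carrier_vec n"
  shows "root_vec n i j \<bullet> v = (v $ i - v $ j) / sqrt 2"
proof -
  have "(unit_vec n i - unit_vec n j) \<bullet> v = v $ i - v $ j"
    using assms by (simp add: minus_scalar_prod_distrib[of _ n])
  then show ?thesis
    using assms by (simp add: root_vec_def scalar_prod_smult_left)
qed

lemma root_vec_norm:
  assumes "i < n" "j < n" "i \<noteq> j"
  shows "root_vec n i j \<bullet> root_vec n i j = 1"
  using assms by (simp add: scalar_prod_root_vec root_vec_index field_simps)

text \<open>On the hyperplane orthogonal to this root the coordinates \<open>i\<close> and
  \<open>j\<close> agree, and reflecting in it swaps these two coordinates.\<close>

lemma refl_mat_root_vec:
  assumes "i < n" "j < n" "i \<noteq> j"
  shows "refl_mat n (root_vec n i j) = perm_mat n (Transposition.transpose i j)"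
  by (rule eq_matI)
    (use assms in \<open>auto simp: refl_mat_def perm_mat_def root_vec_norm root_vec_index
      Transposition.transpose_def field_simps\<close>)

definition sym_mats :: "nat \<Rightarrow> real mat set" where
  "sym_mats n = perm_mat n ` {p. p permutes {..<n}}"

lemma sym_mats_eq_generate: "sym_mats n = generate (GL n) (block_gens n n)"
  unfolding generate_block_gens[OF order.refl] sym_mats_def by (auto simp: permutes_image)

text \<open>Presents the generators as reflections in roots, which yields both
  \<open>block_gens n n \<subseteq> reflections n\<close> and the condition on the sets
  \<open>S i\<close>.\<close>

lemma block_gens_eq:
  "block_gens n k = refl_mat n ` {root_vec n i (Suc i) | i. Suc i < n \<and> Suc i \<noteq> k}"
proof -
  have "refl_mat n ` {root_vec n i (Suc i) | i. Suc i < n \<and> Suc i \<noteq> k} =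
      {refl_mat n (root_vec n i (Suc i)) | i. Suc i < n \<and> Suc i \<noteq> k}" by blast
  also have "\<dots> = block_gens n k"
    unfolding block_gens_def
    by (rule Collect_cong, rule ex_cong1) (auto simp: refl_mat_root_vec)
  finally show ?thesis by simp
qed

lemma finite_reflection_group_sym_mats: "finite_reflection_group n (sym_mats n)"
proof -
  have "finite (sym_mats n)"
    unfolding sym_mats_def by (intro finite_imageI finite_permutations) simp
  moreover have "root_vec n i (Suc i) \<noteq> 0\<^sub>v n" if "Suc i < n" for i
    using root_vec_norm[of i n "Suc i"] that by (metis Suc_lessD n_not_Suc_n root_vec_carrier scalar_prod_left_zero zero_neq_one)
  then have "block_gens n n \<subseteq> reflections n"
    unfolding block_gens_eq reflections_def by fastforce
  ultimately show ?thesis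
    unfolding finite_reflection_group_def using sym_mats_eq_generate by blast
qed

text \<open>A reflection negates its root, whereas the identity fixes it. This excludes
  \<open>p = id\<close> when the roots are determined.\<close>

lemma one_mat_not_reflection: "1\<^sub>m n \<notin> reflections n"
proof
  assume "1\<^sub>m n \<in> reflections n"
  then obtain \<beta> where \<beta>: "\<beta> \<in> carrier_vec n" "\<beta> \<noteq> 0\<^sub>v n" "1\<^sub>m n = refl_mat n \<beta>"
    by (auto simp: reflections_def)
  have pos: "\<beta> \<bullet> \<beta> \<noteq> 0" using \<beta>(1,2) conjugate_square_eq_0_vec[of \<beta> n] by simp
  have "\<beta> = refl_mat n \<beta> *\<^sub>v \<beta>" using \<beta> by (metis one_mult_mat_vec)
  also have "\<dots> = \<beta> - 2 \<cdot>\<^sub>v \<beta>" using pos by (simp add: refl_mat_mult_vec[OF \<beta>(1,1)])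
  finally have eq: "\<beta> = \<beta> - 2 \<cdot>\<^sub>v \<beta>" .
  have "\<beta> $ i = 0" if "i < n" for i
    using arg_cong[OF eq, of "\<lambda>v. v $ i"] that \<beta>(1) by simp
  then show False using \<beta>(1,2) by (auto intro: eq_vecI)
qed

text \<open>A nontrivial permutation matrix fixes the hyperplane orthogonal to \<open>\<alpha>\<close> pointwise only if
  the functional \<open>v \<mapsto> v\<^sub>i - v\<^sub>j\<close> vanishes there for some \<open>i \<noteq> j\<close>, which forces \<open>\<alpha>\<close> to be a
  multiple of \<open>e\<^sub>i - e\<^sub>j\<close>.\<close>

lemma root_system_sym_mats:
  "root_system n (sym_mats n) = {root_vec n i j | i j. i < n \<and> j < n \<and> i \<noteq> j}" (is "?L = ?R")
proof
  show "?L \<subseteq> ?R"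
  proof
    fix \<alpha> assume "\<alpha> \<in> ?L"
    then obtain s where \<alpha>: "\<alpha> \<in> carrier_vec n" "\<alpha> \<bullet> \<alpha> = 1" and s: "s \<in> sym_mats n" "s \<in> reflections n"
      and fixed: "\<And>v. v \<in> carrier_vec n \<Longrightarrow> \<alpha> \<bullet> v = 0 \<Longrightarrow> s *\<^sub>v v = v"
      by (auto simp: root_system_def)
    from s(1) obtain p where p: "p permutes {..<n}" "s = perm_mat n p" by (auto simp: sym_mats_def)
    have "p \<noteq> id" using s(2) p(2) one_mat_not_reflection by (auto simp: perm_mat_id)
    then obtain j where j: "p j \<noteq> j" by (auto simp: fun_eq_iff)
    have jn: "j < n" using j p(1) permutes_not_in[of p "{..<n}" j] by auto
    have pjn: "p j < n" using permutes_in_image[OF p(1), of j] jn by simp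
    define w where "w = root_vec n (p j) j"
    define c where "c = \<alpha> \<bullet> w"
    \<comment> \<open>As \<open>\<alpha>\<close> is a unit vector, \<open>v\<close> is the
      orthogonal projection of \<open>w\<close> to the hyperplane of \<open>\<alpha>\<close>, so
      \<open>s\<close> fixes it.\<close>
    define v where "v = w - c \<cdot>\<^sub>v \<alpha>"
    have carr: "w \<in> carrier_vec n" "v \<in> carrier_vec n" using \<alpha> by (auto simp: w_def v_def)
    have av: "\<alpha> \<bullet> v = 0"
      using \<alpha> carr(1) by (simp add: v_def scalar_prod_minus_distrib[of _ n] c_def)
    \<comment> \<open>The matrix \<open>s\<close> moves entry \<open>j\<close> of \<open>v\<close>
      to position \<open>p j\<close>; since \<open>s\<close> fixes \<open>v\<close>, the two entries
      agree and \<open>v\<close> is orthogonal to \<open>w\<close>.\<close>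
    have "v $ p j = v $ j"
      using perm_mat_mult_vec[OF p(1) carr(2) jn] fixed[OF carr(2) av] p(2) by simp
    then have wv: "w \<bullet> v = 0"
      using carr jn pjn by (simp add: w_def scalar_prod_root_vec)
    \<comment> \<open>\<open>v\<close> is orthogonal to both vectors that it is combined from, hence
      zero, so \<open>w\<close> is a multiple of \<open>\<alpha>\<close>.\<close>
    have "v \<bullet> v = w \<bullet> v - c * (\<alpha> \<bullet> v)"
      using \<alpha> carr by (subst v_def) (simp add: minus_scalar_prod_distrib[of _ n])
    then have "v = 0\<^sub>v n"
      using av wv carr(2) conjugate_square_eq_0_vec[of v n] by simp
    have w: "w = c \<cdot>\<^sub>v \<alpha>"
    proof (rule eq_vecI)
      fix i assume "i < dim_vec (c \<cdot>\<^sub>v \<alpha>)"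
      then have i: "i < n" using \<alpha> by simp
      have "v $ i = 0" using \<open>v = 0\<^sub>v n\<close> i by simp
      then show "w $ i = (c \<cdot>\<^sub>v \<alpha>) $ i" using i \<alpha> carr by (simp add: v_def)
    qed (use \<alpha> carr in simp)
    have "w \<bullet> w = 1" using root_vec_norm j jn pjn by (simp add: w_def)
    moreover have "w \<bullet> w = c * c" unfolding w using \<alpha> by simp
    \<comment> \<open>Both vectors have length 1; the sign -1 amounts to exchanging the two indices
      of the root.\<close>
    ultimately have "c = 1 \<or> c = -1" by (simp add: square_eq_1_iff)
    then show "\<alpha> \<in> ?R"
    proof
      assume "c = 1"
      then have "\<alpha> = root_vec n (p j) j" using w by (simp add: w_def)
      then show ?thesis using j jn pjn by blast
    next
      assume c: "c = -1"
      have "\<alpha> = root_vec n j (p j)"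
      proof (rule eq_vecI)
        fix i assume "i < dim_vec (root_vec n j (p j))"
        then have i: "i < n" by (simp add: root_vec_def)
        have "w $ i = - \<alpha> $ i" using i \<alpha> by (simp add: w c)
        then show "\<alpha> $ i = root_vec n j (p j) $ i"
          using i by (simp add: w_def root_vec_index field_simps)
      qed (use \<alpha> in \<open>simp add: root_vec_def\<close>)
      then show ?thesis using j[symmetric] jn pjn by blast
    qed
  qed
next
  show "?R \<subseteq> ?L"
  proof clarify
    fix i j assume ij: "i < n" "j < n" "i \<noteq> j"
    let ?s = "refl_mat n (root_vec n i j)"
    have "Transposition.transpose i j permutes {..<n}"
      using ij by (intro permutes_swap_id) auto
    then have "?s \<in> sym_mats n" using ij by (simp add: refl_mat_root_vec sym_mats_def)
    moreover have "root_vec n i j \<noteq> 0\<^sub>v n"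
      using root_vec_norm[OF ij] by (metis root_vec_carrier scalar_prod_left_zero zero_neq_one)
    then have "?s \<in> reflections n" unfolding reflections_def by auto
    moreover have "?s *\<^sub>v v = v" if "v \<in> carrier_vec n" "root_vec n i j \<bullet> v = 0" for v
      using that by (simp add: refl_mat_mult_vec) (auto intro!: eq_vecI simp: root_vec_def)
    ultimately show "root_vec n i j \<in> ?L"
      using root_vec_norm[OF ij] by (auto simp: root_system_def)
  qed
qed

section \<open>Positive roots with respect to the standard basis\<close>

lemma ordered_basis_unit_vecs: "ordered_basis n (unit_vecs n)"
  unfolding ordered_basis_def
  using vec_space.unit_vecs_basis vec_space.unit_vecs_distinct by blast

lemma vec_lincomb_unit_vecs:
  assumes "i < n"
  shows "vec_lincomb n c (set (unit_vecs n)) $ i = c (unit_vecs n ! i)"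
  unfolding vec_space.lincomb_units[OF assms] using assms by (simp add: unit_vecs_def)

lemma vec_lincomb_carrier:
  assumes "X \<subseteq> carrier_vec n"
  shows "vec_lincomb n c X \<in> carrier_vec n"
proof -
  interpret vec_space "TYPE(real)" n .
  show ?thesis using assms by (rule lincomb_closed)
qed

text \<open>The first nonzero coordinate of e_i - e_j sits at min(i, j), and it is positive exactly
  when that minimum is i.\<close>

lemma positive_roots_sym_mats:
  "positive_roots n (sym_mats n) (unit_vecs n) = {root_vec n i j | i j. i < j \<and> j < n}" (is "?L = ?R")
proof
  show "?L \<subseteq> ?R"
  proof
    fix \<alpha> assume "\<alpha> \<in> ?L"
    then obtain i j c l where ij: "i < n" "j < n" "i \<noteq> j" and \<alpha>: "\<alpha> = root_vec n i j"
      "\<alpha> = vec_lincomb n c (set (unit_vecs n))"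
      and l: "l < n" "c (unit_vecs n ! l) > 0" "\<forall>a<l. c (unit_vecs n ! a) = 0"
      unfolding positive_roots_def root_system_sym_mats by (auto simp: unit_vecs_def)
    have coord: "c (unit_vecs n ! a) = root_vec n i j $ a" if "a < n" for a
      using \<alpha> that by (simp add: vec_lincomb_unit_vecs[symmetric])
    have "root_vec n i j $ l > 0" using coord l by simp
    then have "l = i" using l(1) by (auto simp: root_vec_index split: if_splits)
    then have "\<not> j < i" using coord[of j] ij l by (auto simp: root_vec_index)
    then have "i < j" using ij(3) by simp
    then show "\<alpha> \<in> ?R" using ij(2) \<alpha>(1) by blast
  qed
next
  show "?R \<subseteq> ?L"
  proof clarify
    fix i j assume ij: "i < j" "j < n"
    \<comment> \<open>\<open>vec_lincomb\<close> takes its coefficients as a function on vectors, so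
      the coordinates of the root are attached to the unit vectors themselves.\<close>
    define c where "c v = (if v = unit_vec n i then 1 / sqrt 2 else if v = unit_vec n j then - (1 / sqrt 2) else 0)"
      for v :: "real vec"
    have c: "c (unit_vecs n ! a) = root_vec n i j $ a" if "a < n" for a
      using ij that by (auto simp: c_def unit_vecs_def root_vec_index)
    have "root_vec n i j = vec_lincomb n c (set (unit_vecs n))"
      by (rule eq_vecI)
        (use c vec_lincomb_carrier[OF unit_vecs_carrier[of n], of c] in \<open>auto simp: vec_lincomb_unit_vecs root_vec_def\<close>)
    moreover have "c (unit_vecs n ! i) > 0 \<and> (\<forall>a<i. c (unit_vecs n ! a) = 0)"
      using ij c by (simp add: root_vec_index)
    moreover have "root_vec n i j \<in> root_system n (sym_mats n)"
      unfolding root_system_sym_mats using ij by force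
    moreover have "i < length (unit_vecs n)" using ij by (simp add: unit_vecs_def)
    ultimately show "root_vec n i j \<in> ?L"
      unfolding positive_roots_def by blast
  qed
qed

section \<open>The simple system\<close>

definition simple_roots :: "nat \<Rightarrow> real vec set" where
  "simple_roots n = {root_vec n i (Suc i) | i. Suc i < n}"

lemma vec_lincomb_index:
  assumes "a < n" "D \<subseteq> simple_roots n"
  shows "vec_lincomb n c D $ a = (\<Sum>\<beta>\<in>D. c \<beta> * \<beta> $ a)"
proof (rule vec_space.lincomb_index[OF assms(1)])
  show "D \<subseteq> carrier_vec n" using assms(2) by (auto simp: simple_roots_def)
qed

text \<open>Up to scaling, summing the coordinates up to \<open>l\<close> is the linear functional dual to the \<open>l\<close>-th
  simple root; this gives the minimality of the simple system.\<close>

lemma sum_root_vec_prefix: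
  assumes "Suc i < n" "Suc l < n"
  shows "(\<Sum>a\<le>l. root_vec n i (Suc i) $ a) = (if i = l then 1 / sqrt 2 else 0)"
proof -
  have "(\<Sum>a\<le>l. root_vec n i (Suc i) $ a) =
      (\<Sum>a\<le>l. (if a = i then 1 / sqrt 2 else 0) - (if a = Suc i then 1 / sqrt 2 else 0))"
    using assms by (intro sum.cong) (auto simp: root_vec_index)
  also have "\<dots> = (if i \<le> l then 1 / sqrt 2 else 0) - (if Suc i \<le> l then 1 / sqrt 2 else 0)"
    by (simp add: sum_subtractf)
  finally show ?thesis by auto
qed

text \<open>Spanning is telescoping: e_i - e_j is the sum of e_l - e_(l+1) over i \<le> l < j, so 0
  and 1 suffice as coefficients. For minimality, a prefix sum detects the omitted simple
  root.\<close>

lemma simple_system_simple_roots: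
  "simple_system n (positive_roots n (sym_mats n) (unit_vecs n)) (simple_roots n)"
  unfolding simple_system_def
proof (intro conjI allI impI)
  show "simple_roots n \<subseteq> positive_roots n (sym_mats n) (unit_vecs n)"
    unfolding positive_roots_sym_mats simple_roots_def by force
  \<comment> \<open>Prefix sums tell the simple roots apart; injectivity then lets a sum over a set
    of roots be reindexed by \<open>l\<close>.\<close>
  have inj: "inj_on (\<lambda>i. root_vec n i (Suc i)) {i. Suc i < n}"
  proof (rule inj_onI)
    fix i l assume "i \<in> {i. Suc i < n}" "l \<in> {i. Suc i < n}"
      and "root_vec n i (Suc i) = root_vec n l (Suc l)"
    then show "i = l"
      using sum_root_vec_prefix[of i n l] sum_root_vec_prefix[of l n l] by (auto split: if_splits)
  qed
  have simple_image: "simple_roots n = (\<lambda>i. root_vec n i (Suc i)) ` {i. Suc i < n}"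
    by (auto simp: simple_roots_def)
  show "nonneg_spans n (simple_roots n) (positive_roots n (sym_mats n) (unit_vecs n))"
    unfolding nonneg_spans_def positive_roots_sym_mats
  proof clarify
    fix i j assume ij: "i < j" "j < n"
    define c :: "real vec \<Rightarrow> real"
      where "c \<beta> = (if \<beta> \<in> (\<lambda>l. root_vec n l (Suc l)) ` {i..<j} then 1 else 0)" for \<beta>
    have "root_vec n i j = vec_lincomb n c (simple_roots n)"
    proof (rule eq_vecI)
      have "simple_roots n \<subseteq> carrier_vec n" by (auto simp: simple_roots_def)
      then have lc: "vec_lincomb n c (simple_roots n) \<in> carrier_vec n" by (rule vec_lincomb_carrier)
      then show "dim_vec (root_vec n i j) = dim_vec (vec_lincomb n c (simple_roots n))"
        by (simp add: root_vec_def)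
      fix a assume "a < dim_vec (vec_lincomb n c (simple_roots n))"
      then have a: "a < n" using lc by simp
      have fin: "finite (simple_roots n)"
        unfolding simple_image by (rule finite_imageI) (rule finite_subset[of _ "{..<n}"], auto)
      have sub: "(\<lambda>l. root_vec n l (Suc l)) ` {i..<j} \<subseteq> simple_roots n"
        using ij unfolding simple_image by auto
      have "vec_lincomb n c (simple_roots n) $ a = (\<Sum>\<beta>\<in>simple_roots n. c \<beta> * \<beta> $ a)"
        using a by (simp add: vec_lincomb_index)
      also have "\<dots> = (\<Sum>\<beta>\<in>(\<lambda>l. root_vec n l (Suc l)) ` {i..<j}. \<beta> $ a)"
        using fin sub by (intro sum.mono_neutral_cong_right) (auto simp: c_def)
      also have "\<dots> = (\<Sum>l=i..<j. root_vec n l (Suc l) $ a)"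
        by (subst sum.reindex) (use ij in \<open>auto intro: inj_on_subset[OF inj]\<close>)
      also have "\<dots> = (\<Sum>l=i..<j. (if a = l then 1 / sqrt 2 else 0) - (if a = Suc l then 1 / sqrt 2 else 0))"
        using a by (intro sum.cong) (auto simp: root_vec_index)
      \<comment> \<open>The sign is turned so that each summand has the form
        \<open>f (Suc l) - f l\<close>, as \<open>sum_Suc_diff'\<close> expects.\<close>
      also have "\<dots> = - (\<Sum>l=i..<j. (if a = Suc l then 1 / sqrt 2 else 0) - (if a = l then 1 / sqrt 2 else 0))"
        by (simp add: sum_subtractf)
      also have "\<dots> = root_vec n i j $ a"
        using a ij sum_Suc_diff'[of i j "\<lambda>l. if a = l then 1 / sqrt 2 else 0"]
        by (simp add: root_vec_index)
      finally show "root_vec n i j $ a = vec_lincomb n c (simple_roots n) $ a" by simp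
    qed
    moreover have "\<forall>\<beta>\<in>simple_roots n. c \<beta> \<ge> 0" by (simp add: c_def)
    ultimately show "\<exists>c. (\<forall>\<beta>\<in>simple_roots n. c \<beta> \<ge> 0) \<and> root_vec n i j = vec_lincomb n c (simple_roots n)"
      by blast
  qed
  fix D assume D: "D \<subset> simple_roots n"
  then obtain l where l: "Suc l < n" "root_vec n l (Suc l) \<notin> D" by (auto simp: simple_roots_def)
  show "\<not> nonneg_spans n D (positive_roots n (sym_mats n) (unit_vecs n))"
  proof
    assume "nonneg_spans n D (positive_roots n (sym_mats n) (unit_vecs n))"
    moreover have "root_vec n l (Suc l) \<in> positive_roots n (sym_mats n) (unit_vecs n)"
      unfolding positive_roots_sym_mats using l(1) by force
    ultimately obtain c where c: "root_vec n l (Suc l) = vec_lincomb n c D"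
      unfolding nonneg_spans_def by blast
    \<comment> \<open>The prefix sum up to \<open>l\<close> is \<open>1 / sqrt 2\<close> on the
      omitted root but 0 on every member of \<open>D\<close>.\<close>
    have "(\<Sum>a\<le>l. root_vec n l (Suc l) $ a) = (\<Sum>a\<le>l. \<Sum>\<beta>\<in>D. c \<beta> * \<beta> $ a)"
      unfolding c using D l(1) by (intro sum.cong refl vec_lincomb_index) auto
    also have "\<dots> = (\<Sum>\<beta>\<in>D. c \<beta> * (\<Sum>a\<le>l. \<beta> $ a))"
      by (subst sum.swap) (simp add: sum_distrib_left)
    also have "\<dots> = 0"
    proof (rule sum.neutral, rule ballI)
      fix \<beta> assume "\<beta> \<in> D"
      with D l obtain i where "\<beta> = root_vec n i (Suc i)" "Suc i < n" "i \<noteq> l"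
        by (auto simp: simple_roots_def)
      then show "c \<beta> * (\<Sum>a\<le>l. \<beta> $ a) = 0" using l(1) by (simp add: sum_root_vec_prefix)
    qed
    finally show False using sum_root_vec_prefix[OF l(1) l(1)] by simp
  qed
qed

section \<open>The isomorphism\<close>

text \<open>Any member of a coset determines its set. The permutation \<open>p\<close> guarantees a
  member: sets of the wrong size all give the empty coset.\<close>

lemma perm_coset_inj:
  assumes "perm_coset n k U = perm_coset n k W" "p permutes {..<n}" "Suc ` p ` {..<k} = U"
  shows "U = W"
proof -
  have "perm_mat n p \<in> perm_coset n k W" using assms by (auto simp: perm_coset_def)
  then obtain q where "q permutes {..<n}" "Suc ` q ` {..<k} = W" "perm_mat n p = perm_mat n q"
    by (auto simp: perm_coset_def)
  then show ?thesis using assms(2,3) inj_onD[OF perm_mat_inj, of n p q] by auto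
qed

text \<open>The symmetric group acts transitively on pairs of a \<open>k\<close>-set and a point in
  it. A single permutation for both is what an edge demands, since its two cosets share a
  representative.\<close>

lemma exists_perm_of_flag:
  assumes "U \<subseteq> {1..n}" "card U = k" "v \<in> U"
  obtains p where "p permutes {..<n}" "Suc ` p ` {..<k} = U" "Suc (p 0) = v"
proof -
  define W where "W = {x. Suc x \<in> U}"
  have SW: "Suc ` W = U"
  proof
    show "U \<subseteq> Suc ` W"
    proof
      fix u assume "u \<in> U"
      moreover from this have "u = Suc (u - 1)" using assms(1) by auto
      ultimately show "u \<in> Suc ` W" unfolding W_def by (metis imageI mem_Collect_eq)
    qed
  qed (auto simp: W_def)
  have W: "W \<subseteq> {..<n}" using assms(1) by (auto simp: W_def)
  have finW: "finite W" using W finite_subset by blast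
  have cW: "card W = k" using SW assms(2) card_image[of Suc W] by simp
  obtain x where x: "x \<in> W" "Suc x = v" using SW assms(3) by blast
  have "k \<le> n" using cW W card_mono[of "{..<n}" W] by simp
  \<comment> \<open>Bijections onto \<open>W\<close> and onto its complement are glued to a
    permutation \<open>h\<close>.\<close>
  have "card {k..<n} = card ({..<n} - W)" using cW W finW by (simp add: card_Diff_subset)
  then obtain h2 where h2: "bij_betw h2 {k..<n} ({..<n} - W)"
    using finite_same_card_bij[of "{k..<n}" "{..<n} - W"] by auto
  obtain h1 where h1: "bij_betw h1 {..<k} W"
    using finite_same_card_bij[of "{..<k}" W] finW cW by auto
  define h where "h i = (if i < k then h1 i else if i < n then h2 i else i)" for i
  have "bij_betw h {..<k} W" using h1 by (rule bij_betw_cong[THEN iffD1, rotated]) (simp add: h_def)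
  moreover have "bij_betw h {k..<n} ({..<n} - W)"
    using h2 by (rule bij_betw_cong[THEN iffD1, rotated]) (simp add: h_def)
  ultimately have "bij_betw h ({..<k} \<union> {k..<n}) (W \<union> ({..<n} - W))"
    by (rule bij_betw_combine) auto
  moreover have "{..<k} \<union> {k..<n} = {..<n}" using \<open>k \<le> n\<close> by auto
  moreover have "W \<union> ({..<n} - W) = {..<n}" using W by auto
  ultimately have h: "h permutes {..<n}"
    using \<open>k \<le> n\<close> by (intro bij_imp_permutes) (auto simp: h_def)
  have hW: "h ` {..<k} = W" using \<open>bij_betw h {..<k} W\<close> by (simp add: bij_betw_def)
  \<comment> \<open>\<open>h\<close> may send a point other than 0 to \<open>x\<close>. Precomposing
    with the swap of 0 and that point \<open>j < k\<close> corrects this and keeps the image of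
    \<open>{..<k}\<close>.\<close>
  with x obtain j where j: "j < k" "h j = x" by auto
  have t: "Transposition.transpose 0 j permutes {..<n}" "Transposition.transpose 0 j permutes {..<k}"
    using j \<open>k \<le> n\<close> by (auto intro!: permutes_swap_id)
  show thesis
  proof
    show "(h \<circ> Transposition.transpose 0 j) permutes {..<n}" using t(1) h by (rule permutes_compose)
    have "(h \<circ> Transposition.transpose 0 j) ` {..<k} = W"
      unfolding image_comp[symmetric] permutes_image[OF t(2)] by (rule hW)
    then show "Suc ` (h \<circ> Transposition.transpose 0 j) ` {..<k} = U" using SW by simp
    show "Suc ((h \<circ> Transposition.transpose 0 j) 0) = v" using j x by simp
  qed
qed

theorem theorem3p5:
  fixes n t :: nat and k :: "nat \<Rightarrow> nat"
  assumes "n \<ge> 1" and "t \<ge> 1"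
    and "\<And>i. i \<in> {1..t} \<Longrightarrow> k i \<in> {1..n}"
  shows "\<exists>H. left_reflection_bigraph H \<and> bigraph_iso (complete_incidence_bigraph n t k) H"
proof -
  \<comment> \<open>Index 0 gets block size 1, for the left vertices. The default 1 beyond
    \<open>t\<close> keeps \<open>d i\<close> between 1 and \<open>n\<close> for every
    \<open>i\<close>.\<close>
  define d where "d i = (if i = 0 then 1 else if i \<le> t then k i else 1)" for i
  have d: "d 0 = 1" "\<And>i. i \<in> {1..t} \<Longrightarrow> d i = k i" "\<And>i. d i \<le> n" "\<And>i. d i \<ge> 1"
    using assms by (auto simp: d_def)
  define S where "S i = block_gens n (d i)" for i
  define H where "H = coset_bigraph n (sym_mats n) S t"
  have "S i \<subseteq> refl_mat n ` simple_roots n" for i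
    unfolding S_def block_gens_eq simple_roots_def by blast
  then have lrb: "left_reflection_bigraph H"
    unfolding left_reflection_bigraph_def H_def
    by (intro exI[of _ n] exI[of _ "sym_mats n"] exI[of _ "unit_vecs n"] exI[of _ "simple_roots n"]
        exI[of _ t] exI[of _ S] conjI assms allI impI finite_reflection_group_sym_mats
        ordered_basis_unit_vecs simple_system_simple_roots refl)
  let ?P = "{p. p permutes {..<n}}"
  have coset: "perm_mat n p <#\<^bsub>GL n\<^esub> generate (GL n) (S i) = perm_coset n (d i) (Suc ` p ` {..<d i})"
    if "p \<in> ?P" for p i
    using that d by (simp add: S_def l_coset_block_gens)
  \<comment> \<open>The block \<open>{..<1}\<close> has the single image point \<open>p 0\<close>,
    so cosets of type 1 correspond to vertices.\<close>
  have left: "left_verts H = {perm_coset n 1 {Suc (p 0)} | p. p \<in> ?P}"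
    unfolding H_def coset_bigraph_def Let_def sym_mats_def
    using coset[of _ 0] by (auto simp: d(1) lessThan_Suc)
  have right: "right_verts H = {(perm_coset n (k i) (Suc ` p ` {..<k i}), i) | p i. p \<in> ?P \<and> i \<in> {1..t}}"
    unfolding H_def coset_bigraph_def Let_def sym_mats_def
    using coset d(2) by fastforce
  have edges: "edges H = {(perm_coset n 1 {Suc (p 0)}, (perm_coset n (k i) (Suc ` p ` {..<k i}), i)) | p i.
      p \<in> ?P \<and> i \<in> {1..t}}"
    unfolding H_def coset_bigraph_def Let_def sym_mats_def
    using coset[of _ 0] coset d(2) by (fastforce simp: d(1) lessThan_Suc)
  let ?G = "complete_incidence_bigraph n t k"
  let ?f = "\<lambda>v. perm_coset n 1 {v}"
  let ?g = "\<lambda>(U, i). (perm_coset n (k i) U, i)"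
  have img: "Suc ` p ` {..<l} \<subseteq> {1..n}" "card (Suc ` p ` {..<l}) = l"
    if "p \<in> ?P" "l \<le> n" for p l
  proof -
    have p: "p permutes {..<n}" using that(1) by simp
    have "p x < n" if "x < l" for x
      using permutes_in_image[OF p, of x] that \<open>l \<le> n\<close> by simp
    then show "Suc ` p ` {..<l} \<subseteq> {1..n}" by fastforce
    have "card (p ` {..<l}) = l"
      using inj_on_subset[OF permutes_inj[OF p]] by (simp add: card_image)
    then show "card (Suc ` p ` {..<l}) = l" by (simp add: card_image)
  qed
  have left_G: "left_verts ?G = {1..n}"
    and right_G: "(U, i) \<in> right_verts ?G \<longleftrightarrow> i \<in> {1..t} \<and> U \<subseteq> {1..n} \<and> card U = k i"
    and edges_G: "(v, (U, i)) \<in> edges ?G \<longleftrightarrow> (U, i) \<in> right_verts ?G \<and> v \<in> U" for U i v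
    by (auto simp: complete_incidence_bigraph_def)
  have single: "\<exists>p\<in>?P. Suc (p 0) = v" if "v \<in> {1..n}" for v
    using exists_perm_of_flag[of "{v}" n 1 v] that by auto
  have flag: "\<exists>p\<in>?P. Suc ` p ` {..<k i} = U \<and> Suc (p 0) = v"
    if U: "(U, i) \<in> right_verts ?G" and v: "v \<in> U" for U i v
  proof -
    have "U \<subseteq> {1..n}" "card U = k i" using U unfolding right_G by auto
    then obtain p where "p permutes {..<n}" "Suc ` p ` {..<k i} = U" "Suc (p 0) = v"
      using v by (rule exists_perm_of_flag)
    then show ?thesis by blast
  qed
  \<comment> \<open>Since \<open>k i \<ge> 1\<close>, every right vertex contains a point, so
    \<open>flag\<close> provides a representative for it.\<close>
  have nonempty: "\<exists>v. v \<in> U" if "(U, i) \<in> right_verts ?G" for U i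
    using that assms(3)[of i] unfolding right_G by (cases "U = {}") auto
  have perm1: "Suc ` p ` {..<1} = {Suc (p 0)}" for p :: "nat \<Rightarrow> nat"
    by (simp add: lessThan_Suc)

  \<comment> \<open>Bijections between the vertex sets\<close>
  have f_inj: "v = w" if eq: "?f v = ?f w" and v: "v \<in> {1..n}" for v w
  proof -
    obtain p where "p \<in> ?P" "Suc (p 0) = v" using single v by blast
    then have "{v} = {w}" using perm_coset_inj[OF eq, of p] perm1[of p] by simp
    then show ?thesis by simp
  qed
  have g_inj: "U = W"
    if eq: "perm_coset n (k i) U = perm_coset n (k i) W" and U: "(U, i) \<in> right_verts ?G" for U W i
  proof -
    obtain p where "p \<in> ?P" "Suc ` p ` {..<k i} = U" using flag nonempty U by blast
    then show ?thesis using perm_coset_inj[OF eq, of p] by simp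
  qed
  have "?f ` left_verts ?G = left_verts H"
  proof
    show "?f ` left_verts ?G \<subseteq> left_verts H" unfolding left left_G using single by blast
    show "left_verts H \<subseteq> ?f ` left_verts ?G"
      unfolding left left_G using img(1)[of _ 1] assms(1) unfolding perm1 by blast
  qed
  moreover have "inj_on ?f (left_verts ?G)" unfolding left_G by (rule inj_onI) (rule f_inj)
  ultimately have f: "bij_betw ?f (left_verts ?G) (left_verts H)" by (simp add: bij_betw_def)
  have "?g ` right_verts ?G = right_verts H"
  proof
    show "?g ` right_verts ?G \<subseteq> right_verts H"
    proof clarify
      fix U i assume U: "(U, i) \<in> right_verts ?G"
      then obtain p where "p \<in> ?P" "Suc ` p ` {..<k i} = U" using flag nonempty by blast
      then show "(perm_coset n (k i) U, i) \<in> right_verts H" using U unfolding right right_G by blast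
    qed
    show "right_verts H \<subseteq> ?g ` right_verts ?G"
    proof
      fix y assume "y \<in> right_verts H"
      then obtain p i where y: "y = ?g (Suc ` p ` {..<k i}, i)" and "p \<in> ?P" "i \<in> {1..t}"
        unfolding right by auto
      then have "(Suc ` p ` {..<k i}, i) \<in> right_verts ?G"
        using img assms(3) unfolding right_G by simp
      then show "y \<in> ?g ` right_verts ?G" unfolding y by (rule imageI)
    qed
  qed
  moreover have "inj_on ?g (right_verts ?G)" using g_inj by (auto intro!: inj_onI)
  ultimately have g: "bij_betw ?g (right_verts ?G) (right_verts H)" by (simp add: bij_betw_def)
  have e: "(v, y) \<in> edges ?G \<longleftrightarrow> (?f v, ?g y) \<in> edges H"
    if v: "v \<in> left_verts ?G" and y: "y \<in> right_verts ?G" for v y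
  proof -
    obtain U i where Ui: "y = (U, i)" by (cases y)
    \<comment> \<open>Forward, \<open>flag\<close> gives one representative of both cosets.
      Backward, injectivity identifies \<open>v\<close> and \<open>U\<close> with the point and set
      of the edge's representative \<open>p\<close>, and \<open>0 < k i\<close> puts
      \<open>p 0\<close> into the image of \<open>{..<k i}\<close>.\<close>
    have "v \<in> U \<longleftrightarrow> (?f v, (perm_coset n (k i) U, i)) \<in> edges H"
    proof
      assume "v \<in> U"
      then obtain p where "p \<in> ?P" "Suc ` p ` {..<k i} = U" "Suc (p 0) = v"
        using flag y Ui by blast
      then show "(?f v, (perm_coset n (k i) U, i)) \<in> edges H"
        using y unfolding edges Ui right_G by blast
    next
      assume "(?f v, (perm_coset n (k i) U, i)) \<in> edges H"
      then obtain p where p: "?f v = ?f (Suc (p 0))"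
        "perm_coset n (k i) U = perm_coset n (k i) (Suc ` p ` {..<k i})"
        unfolding edges by auto
      have "v = Suc (p 0)" using f_inj p(1) v left_G by simp
      moreover have "U = Suc ` p ` {..<k i}" using g_inj p(2) y Ui by simp
      moreover have "0 < k i" using y Ui assms(3)[of i] right_G by simp
      ultimately show "v \<in> U" by blast
    qed
    then show ?thesis using y edges_G Ui by simp
  qed
  have "right_verts ?G \<subseteq> Pow {1..n} \<times> {1..t}" using right_G by auto
  then have "finite (right_verts ?G)" by (rule finite_subset) simp
  moreover have "edges ?G \<subseteq> left_verts ?G \<times> right_verts ?G"
    by (auto simp: complete_incidence_bigraph_def)
  ultimately have G: "is_bigraph ?G" by (simp add: is_bigraph_def left_G)
  \<comment> \<open>Finiteness passes from the hypergraph to the cosets along the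
    bijections.\<close>
  moreover have "finite (left_verts H)" "finite (right_verts H)"
    using G bij_betw_finite[OF f] bij_betw_finite[OF g] by (simp_all add: is_bigraph_def)
  moreover have "edges H \<subseteq> left_verts H \<times> right_verts H"
    unfolding edges left right by blast
  ultimately have "is_bigraph ?G" "is_bigraph H" by (auto simp: is_bigraph_def)
  then have "bigraph_iso ?G H" unfolding bigraph_iso_def using f g e by blast
  with lrb show ?thesis by blast
qed

end
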